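(* Let $\nu$ be a differentiable norm on $\mathbb{R}^n$ and let $C\subsetneq\mathbb{R}^n$ be a nonempty closed set. Let $\mathbf{U}\subset\mathbb{R}^n$ be a linear subspace with $\dim\mathbf{U}\in\{1,\ldots,n\}$ that is not contained in $C$. Let $d(\mathbf{x})$, $\mathbf{x}\in\mathbf{U}$, be the restriction of $\mathrm{dist}_\nu(\cdot,C)$ to $\mathbf{U}$. Then: 1. $|\mathrm{dist}_\nu(\mathbf{x},C)-\mathrm{dist}_\nu(\mathbf{z},C)|\le\nu(\mathbf{x}-\mathbf{z})$ for all $\mathbf{x},\mathbf{z}\in\mathbb{R}^n$. Hence $\mathrm{dist}_\nu(\cdot,C)$ is Lipschitz. 2. The function $d(\cdot)$ is differentiable almost everywhere in $\mathbf{U}$. 3. Let $\mathbf{x}\in\mathbf{U}\setminus C$ and assume that $d(\cdot)$ is differentiable at $\mathbf{x}$. Let $\partial d(\mathbf{x})$ denote the differential of $d$ at $\mathbf{x}$, viewed as a linear functional on $\mathbf{U}$. Let $\mathbf{y}^\star\in C$ be a best $\nu$-approximation to $\mathbf{x}$. Then $\partial d(\mathbf{x})(\mathbf{u})=\partial\nu(\mathbf{x}-\mathbf{y}^\star)\mathbf{u}$ for each $\mathbf{u}\in\mathbf{U}$. If $\mathbf{z}^\star$ is another best $\nu$-approximation to $\mathbf{x}$, then $\partial\nu(\mathbf{x}-\mathbf{z}^\star)-\partial\nu(\mathbf{x}-\mathbf{y}^\star)$ is orthogonal to $\mathbf{U}$. Suppose furthermore that the dual norm $\nu^*$ is differentiable.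 Then at each point $\mathbf{x}\in\mathbb{R}^n$ where $\mathrm{dist}_\nu(\cdot,C)$ is differentiable, a best $\nu$-approximation is unique.
   Context: For a norm $\nu$ on $\mathbb{R}^n$ and a nonempty closed set $C\subset\mathbb{R}^n$, $\mathrm{dist}_\nu(\mathbf{x},C):=\min\{\nu(\mathbf{x}-\mathbf{y}):\mathbf{y}\in C\}$. A point $\mathbf{y}^\star\in C$ is a best $\nu$-approximation to $\mathbf{x}$ if $\nu(\mathbf{x}-\mathbf{y}^\star)=\mathrm{dist}_\nu(\mathbf{x},C)$. The dual norm is $\nu^*(\mathbf{x})=\max\{\mathbf{y}^\top\mathbf{x}:\nu(\mathbf{y})=1\}$. A norm is called differentiable if it is differentiable on $\mathbb{R}^n\setminus\{\mathbf{0}\}$. For $\mathbf{x}\ne\mathbf{0}$, $\partial\nu(\mathbf{x})$ is the differential of $\nu$ at $\mathbf{x}$, viewed as a row vector in $\mathbb{R}^n$, so the directional derivative in direction $\mathbf{u}$ is $\partial\nu(\mathbf{x})\mathbf{u}$. *)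

theory Defs
  imports "HOL-Analysis.Analysis"
begin

definition is_norm :: "('a::real_vector \<Rightarrow> real) \<Rightarrow> bool" where
  "is_norm \<nu> \<longleftrightarrow>
     (\<forall>x. \<nu> x \<ge> 0) \<and>
     (\<forall>x. \<nu> x = 0 \<longleftrightarrow> x = 0) \<and>
     (\<forall>a x. \<nu> (a *\<^sub>R x) = \<bar>a\<bar> * \<nu> x) \<and>
     (\<forall>x y. \<nu> (x + y) \<le> \<nu> x + \<nu> y)"

definition differentiable_norm :: "('a::real_normed_vector \<Rightarrow> real) \<Rightarrow> bool" where
  "differentiable_norm \<nu> \<longleftrightarrow> \<nu> differentiable_on (UNIV - {0})"

(* The infimum is a minimum for nonempty closed C in finite dimension,
   see best_approx_exists below. *)
definition dist_nu :: "('a::euclidean_space \<Rightarrow> real) \<Rightarrow> 'a set \<Rightarrow> 'a \<Rightarrow> real" where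
  "dist_nu \<nu> C x = (INF y\<in>C. \<nu> (x - y))"

definition best_approx :: "('a::euclidean_space \<Rightarrow> real) \<Rightarrow> 'a set \<Rightarrow> 'a \<Rightarrow> 'a \<Rightarrow> bool" where
  "best_approx \<nu> C x y \<longleftrightarrow> y \<in> C \<and> \<nu> (x - y) = dist_nu \<nu> C x"

(* The supremum is a maximum, see dual_norm_attained below. *)
definition dual_norm :: "('a::euclidean_space \<Rightarrow> real) \<Rightarrow> 'a \<Rightarrow> real" where
  "dual_norm \<nu> x = (SUP y\<in>{y. \<nu> y = 1}. y \<bullet> x)"

(* The differential of f at x as a row vector: its entries are the values of the
   Frechet derivative on the standard basis. *)
definition row_differential :: "(real ^ 'n \<Rightarrow> real) \<Rightarrow> real ^ 'n \<Rightarrow> real ^ 'n" where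
  "row_differential f x = (\<chi> i. frechet_derivative f (at x) (axis i 1))"

definition orthonormal_basis_of :: "'a::euclidean_space set \<Rightarrow> 'a set \<Rightarrow> bool" where
  "orthonormal_basis_of B U \<longleftrightarrow>
     pairwise orthogonal B \<and> (\<forall>b\<in>B. norm b = 1) \<and> span B = U"

(* For orthonormal B, this is Lebesgue (Borel) measure on the subspace span B, transported
   from the coordinate space by the isometry f \<mapsto> (\<Sum>b\<in>B. f b *\<^sub>R b), exactly as lborel is
   obtained from Basis. *)
definition lborel_span :: "'a::euclidean_space set \<Rightarrow> 'a measure" where
  "lborel_span B = distr (\<Pi>\<^sub>M b\<in>B. lborel) (restrict_space borel (span B)) (\<lambda>f. \<Sum>b\<in>B. f b *\<^sub>R b)"

lemma lborel_span_Basis: "lborel_span Basis = (lborel :: 'a::euclidean_space measure)"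
  unfolding lborel_span_def by (subst lborel_eq) (simp cong: distr_cong)

lemma lborel_span_measurable:
  "(\<lambda>f. \<Sum>b\<in>B. f b *\<^sub>R b) \<in>
     measurable (\<Pi>\<^sub>M b\<in>B. lborel) (restrict_space borel (span (B :: 'a::euclidean_space set)))"
  by (rule measurable_restrict_space2)
     (auto intro!: span_sum span_scale intro: span_base borel_measurable_sum
        borel_measurable_scaleR measurable_component_singleton)

lemma orthonormal_basis_of_exists:
  assumes "subspace U"
  shows "\<exists>B. finite B \<and> orthonormal_basis_of B U"
  using orthonormal_basis_subspace[OF assms] independent_imp_finite
  unfolding orthonormal_basis_of_def by metis

lemma frechet_derivative_eq_row_differential:
  fixes f :: "real ^ 'n \<Rightarrow> real"
  assumes "f differentiable (at x)"
  shows "frechet_derivative f (at x) u = row_differential f x \<bullet> u"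
proof -
  let ?D = "frechet_derivative f (at x)"
  have lin: "linear ?D"
    by (rule linear_frechet_derivative[OF assms])
  have "?D u = ?D (\<Sum>i\<in>UNIV. u $ i *\<^sub>R axis i 1)"
    using basis_expansion[of u] by (simp add: scalar_mult_eq_scaleR)
  also have "\<dots> = (\<Sum>i\<in>UNIV. u $ i * ?D (axis i 1))"
    using lin by (simp add: linear_sum linear_scale)
  also have "\<dots> = row_differential f x \<bullet> u"
    by (simp add: row_differential_def inner_vec_def mult.commute)
  finally show ?thesis .
qed

lemma is_norm_minus:
  assumes "is_norm \<nu>"
  shows "\<nu> (- x) = \<nu> x"
proof -
  have "\<nu> ((-1) *\<^sub>R x) = \<bar>-1\<bar> * \<nu> x"
    using assms unfolding is_norm_def by blast
  then show ?thesis by simp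
qed

lemma is_norm_continuous:
  fixes \<nu> :: "'a::euclidean_space \<Rightarrow> real"
  assumes "is_norm \<nu>"
  shows "continuous_on S \<nu>"
proof -
  have "convex_on UNIV \<nu>"
  proof (rule convex_onI)
    fix t :: real and x y :: 'a
    assume t: "0 < t" "t < 1"
    have "\<nu> ((1 - t) *\<^sub>R x + t *\<^sub>R y) \<le> \<nu> ((1 - t) *\<^sub>R x) + \<nu> (t *\<^sub>R y)"
      using assms unfolding is_norm_def by blast
    also have "\<dots> = \<bar>1 - t\<bar> * \<nu> x + \<bar>t\<bar> * \<nu> y"
      using assms unfolding is_norm_def by metis
    finally show "\<nu> ((1 - t) *\<^sub>R x + t *\<^sub>R y) \<le> (1 - t) * \<nu> x + t * \<nu> y"
      using t by simp
  qed auto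
  then show ?thesis
    using convex_on_continuous[of UNIV \<nu>] continuous_on_subset by blast
qed

lemma is_norm_lower_bound:
  fixes \<nu> :: "'a::euclidean_space \<Rightarrow> real"
  assumes "is_norm \<nu>"
  shows "\<exists>c>0. \<forall>x. c * norm x \<le> \<nu> x"
proof -
  have "sphere (0::'a) 1 \<noteq> {}" by simp
  then obtain z :: 'a where z: "norm z = 1" "\<And>x. norm x = 1 \<Longrightarrow> \<nu> z \<le> \<nu> x"
    using continuous_attains_inf[OF compact_sphere _ is_norm_continuous[OF assms], of 0 1] by auto
  have "z \<noteq> 0" using z(1) by auto
  then have pos: "\<nu> z > 0"
    using assms unfolding is_norm_def by (metis less_eq_real_def)
  have "\<nu> z * norm x \<le> \<nu> x" for x
  proof (cases "x = 0")
    case True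
    then show ?thesis using assms unfolding is_norm_def by simp
  next
    case False
    have "\<nu> z \<le> \<nu> ((1 / norm x) *\<^sub>R x)"
      by (rule z(2)) (use False in simp)
    also have "\<dots> = \<bar>1 / norm x\<bar> * \<nu> x"
      using assms unfolding is_norm_def by blast
    also have "\<dots> = \<nu> x / norm x" by simp
    finally show ?thesis using False by (simp add: field_simps)
  qed
  with pos show ?thesis by blast
qed

lemma
  fixes \<nu> :: "'a::euclidean_space \<Rightarrow> real"
  assumes \<nu>: "is_norm \<nu>" and C: "closed C" "C \<noteq> {}"
  shows best_approx_exists: "\<exists>y. best_approx \<nu> C x y"
    and best_approx_iff: "best_approx \<nu> C x y \<longleftrightarrow> y \<in> C \<and> (\<forall>z\<in>C. \<nu> (x - y) \<le> \<nu> (x - z))"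
proof -
  have bdd: "bdd_below ((\<lambda>y. \<nu> (x - y)) ` C)"
    using \<nu> unfolding is_norm_def by (intro bdd_belowI[of _ 0]) auto
  have *: "best_approx \<nu> C x y \<longleftrightarrow> y \<in> C \<and> (\<forall>z\<in>C. \<nu> (x - y) \<le> \<nu> (x - z))" for y
  proof
    assume "best_approx \<nu> C x y"
    then show "y \<in> C \<and> (\<forall>z\<in>C. \<nu> (x - y) \<le> \<nu> (x - z))"
      unfolding best_approx_def dist_nu_def using cINF_lower[OF bdd] by auto
  next
    assume "y \<in> C \<and> (\<forall>z\<in>C. \<nu> (x - y) \<le> \<nu> (x - z))"
    then show "best_approx \<nu> C x y"
      unfolding best_approx_def dist_nu_def
      by (auto intro!: antisym cINF_greatest cINF_lower[OF bdd])
  qed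
  then show "best_approx \<nu> C x y \<longleftrightarrow> y \<in> C \<and> (\<forall>z\<in>C. \<nu> (x - y) \<le> \<nu> (x - z))" .
  obtain c where c: "c > 0" "\<And>x. c * norm x \<le> \<nu> x"
    using is_norm_lower_bound[OF \<nu>] by blast
  obtain w where w: "w \<in> C" using C by blast
  define K where "K = C \<inter> cball x (\<nu> (x - w) / c)"
  have in_K: "y \<in> K" if "y \<in> C" "\<nu> (x - y) \<le> \<nu> (x - w)" for y
    using that c(1) c(2)[of "x - y"] unfolding K_def by (simp add: dist_norm field_simps)
  have "continuous_on K (\<nu> \<circ> (\<lambda>y. x - y))"
    by (intro continuous_on_compose continuous_intros is_norm_continuous[OF \<nu>])
  moreover have "compact K" "K \<noteq> {}"
    using C in_K[OF w] unfolding K_def by (auto intro: closed_Int_compact)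
  ultimately obtain y where y: "y \<in> K" "\<And>z. z \<in> K \<Longrightarrow> \<nu> (x - y) \<le> \<nu> (x - z)"
    using continuous_attains_inf[of K "\<nu> \<circ> (\<lambda>y. x - y)"] by auto
  have "\<nu> (x - y) \<le> \<nu> (x - z)" if "z \<in> C" for z
    using y(2)[OF in_K[OF that]] y(2)[OF in_K[OF w]] by linarith
  then show "\<exists>y. best_approx \<nu> C x y"
    using * y(1) unfolding K_def by blast
qed

lemma
  fixes \<nu> :: "'a::euclidean_space \<Rightarrow> real"
  assumes \<nu>: "is_norm \<nu>"
  shows dual_norm_attained: "\<exists>y. \<nu> y = 1 \<and> y \<bullet> x = dual_norm \<nu> x"
    and dual_norm_upper: "\<nu> y = 1 \<Longrightarrow> y \<bullet> x \<le> dual_norm \<nu> x"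
proof -
  let ?S = "{y. \<nu> y = 1}"
  obtain c where c: "c > 0" "\<And>x. c * norm x \<le> \<nu> x"
    using is_norm_lower_bound[OF \<nu>] by blast
  obtain b :: 'a where b: "b \<in> Basis" using nonempty_Basis by blast
  then have "\<nu> b > 0"
    using \<nu> nonzero_Basis unfolding is_norm_def by (metis less_eq_real_def)
  moreover have "\<nu> ((1 / \<nu> b) *\<^sub>R b) = \<bar>1 / \<nu> b\<bar> * \<nu> b"
    using \<nu> unfolding is_norm_def by blast
  ultimately have "(1 / \<nu> b) *\<^sub>R b \<in> ?S" by simp
  then have ne: "?S \<noteq> {}" by blast
  have "closed ?S"
    using continuous_closed_preimage_constant[OF is_norm_continuous[OF \<nu>] closed_UNIV, of 1] by simp
  moreover have "norm y \<le> 1 / c" if "\<nu> y = 1" for y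
    using c(1) c(2)[of y] that by (simp add: field_simps)
  then have "bounded ?S" by (intro boundedI) auto
  ultimately have "compact ?S" by (simp add: compact_eq_bounded_closed)
  then obtain z where z: "z \<in> ?S" "\<And>y. y \<in> ?S \<Longrightarrow> y \<bullet> x \<le> z \<bullet> x"
    using continuous_attains_sup[of ?S "\<lambda>y. y \<bullet> x"] ne
      continuous_on_inner[OF continuous_on_id continuous_on_const, of ?S x] by blast
  have "dual_norm \<nu> x = z \<bullet> x"
    unfolding dual_norm_def using z by (intro cSup_eq_maximum) auto
  with z show "\<exists>y. \<nu> y = 1 \<and> y \<bullet> x = dual_norm \<nu> x" "\<nu> y = 1 \<Longrightarrow> y \<bullet> x \<le> dual_norm \<nu> x"
    by auto
qed

end

theory Submission
  imports Defs
begin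

text \<open>The Lipschitz bound is the triangle inequality. The formula for the differential of the distance
and the uniqueness of the best approximation rest on one observation: if \<open>y\<close> is a best
approximation to \<open>x\<close>, then \<open>w \<mapsto> \<nu> (w - y)\<close> lies above the distance function and touches it at \<open>x\<close>.
Two functions that touch in this way and are both differentiable at the point of contact have the same
derivative there (\<open>derivative_eq_of_touching_above\<close>), which gives \<open>dist_nu_derivative\<close>. For
uniqueness, two best approximations \<open>y\<close> and \<open>z\<close> yield the same gradient \<open>p\<close> of \<open>\<nu>\<close> at \<open>x - y\<close> and
\<open>x - z\<close>. Both directions, normalized, attain the dual norm of \<open>p\<close>, so both linear functionals
touch the dual norm from below at \<open>p\<close>; if the dual norm is differentiable, the same observation
makes them equal.

The substance is almost everywhere differentiability. Rademacher's theorem would give it, but the distance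
has more structure, which admits a shorter proof. At a point outside \<open>C\<close> it is touched from above by
a translate of \<open>\<nu>\<close>, and at a point of \<open>C\<close> it is touched from below by \<open>0\<close>. So at every point the
distance or its negative has a supergradient. A Lipschitz function is differentiable at almost every point
where it has a supergradient: the exceptional points are
sorted into countably many sets according to an approximate supergradient \<open>q\<close>, an accuracy \<open>\<delta>\<close> and a
radius on which \<open>q\<close> is valid up to \<open>\<delta>\<close>. If \<open>f\<close> fails to be differentiable at such a point \<open>x\<close>, then there are
arbitrarily close points \<open>y\<close> at which \<open>f\<close> is well below its prediction from \<open>x\<close>. By the Lipschitz
condition this persists on a ball around \<open>y\<close> of radius proportional to the distance from \<open>x\<close>, and no point
\<open>z\<close> of that ball can lie in the same set, for \<open>f z\<close> is too small for the upper bound at \<open>z\<close> to reach \<open>f x\<close>.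
Hence each of the countably many sets is porous (\<open>falls_below_approx_porous\<close>), and porous sets are
negligible by Vitali's covering theorem (\<open>uniformly_porous_negligible\<close>).

This argument takes place in a full Euclidean space. To reach a subspace, whose dimension is not the
dimension of a type, the distance is composed with a linear map of the whole space onto the subspace that
forgets the coordinates outside a set \<open>I\<close> of standard basis vectors. By Fubini's theorem, a set that
depends only on the coordinates in \<open>I\<close> is null in the whole space only if it is null in these coordinates
(\<open>AE_lborel_spanI\<close>).\<close>

section \<open>Porous sets are negligible\<close>

text \<open>Porosity at every point with one ratio \<open>c\<close>. The hole lies in the ball \<open>ball x \<rho>\<close> to which its
radius is compared, so that discarding it saves the fixed proportion \<open>c ^ DIM('a)\<close> of that ball.\<close>

definition uniformly_porous :: "real \<Rightarrow> 'a::euclidean_space set \<Rightarrow> bool" where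
  "uniformly_porous c S \<longleftrightarrow>
     (\<forall>x\<in>S. \<forall>r>0. \<exists>\<rho> y. 0 < \<rho> \<and> \<rho> < r \<and> ball y (c * \<rho>) \<subseteq> ball x \<rho> \<and> S \<inter> ball y (c * \<rho>) = {})"

lemma emeasure_ball_minus_ball:
  fixes x y :: "'a::euclidean_space"
  assumes "0 < c" "0 < \<rho>" "ball y (c * \<rho>) \<subseteq> ball x \<rho>"
  shows "emeasure lebesgue (ball x \<rho> - ball y (c * \<rho>))
           = ennreal (1 - c ^ DIM('a)) * emeasure lebesgue (ball x \<rho>)"
proof -
  have "measure lebesgue (ball x \<rho> - ball y (c * \<rho>))
          = measure lebesgue (ball x \<rho>) - measure lebesgue (ball y (c * \<rho>))"
    using assms(3) by (intro measurable_measure_Diff) auto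
  also have "\<dots> = (1 - c ^ DIM('a)) * measure lebesgue (ball x \<rho>)"
    using assms content_ball_conv_unit_ball[of "c * \<rho>" y] content_ball_conv_unit_ball[of "\<rho>" x]
    by (simp add: power_mult_distrib algebra_simps)
  finally have eq: "measure lebesgue (ball x \<rho> - ball y (c * \<rho>))
                 = (1 - c ^ DIM('a)) * measure lebesgue (ball x \<rho>)" .
  have "ball x \<rho> - ball y (c * \<rho>) \<in> lmeasurable"
    by (intro fmeasurable.Diff) auto
  then show ?thesis
    using eq by (simp add: emeasure_eq_measure2 ennreal_mult'')
qed

text \<open>The set is covered, up to a negligible remainder, by disjoint balls inside \<open>V\<close>. Each of them contains a
hole that misses the set, so the holes may be removed from the cover.\<close>

lemma uniformly_porous_shrink_cover:
  fixes S :: "'a::euclidean_space set"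
  assumes por: "uniformly_porous c S" and c: "0 < c" "c < 1"
    and V: "open V" "V \<in> lmeasurable" "S \<subseteq> V"
  obtains W where "W \<in> lmeasurable" "S \<subseteq> W"
    "measure lebesgue W \<le> (1 - c ^ DIM('a)) * measure lebesgue V"
proof -
  let ?q = "1 - c ^ DIM('a)"
  have q: "0 \<le> ?q" using c by (simp add: power_le_one)
  \<comment> \<open>Each index \<open>(x, y, \<rho>)\<close> is a ball together with the centre of its hole.\<close>
  define K where "K = {(x, y, \<rho>). 0 < \<rho> \<and> ball x \<rho> \<subseteq> V \<and>
      ball y (c * \<rho>) \<subseteq> ball x \<rho> \<and> S \<inter> ball y (c * \<rho>) = {}}"
  have cover: "\<exists>i. i \<in> K \<and> x \<in> ball (fst i) (snd (snd i)) \<and> snd (snd i) < d"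
    if "x \<in> S" "0 < d" for x d
  proof -
    obtain e where e: "0 < e" "ball x e \<subseteq> V"
      using V \<open>x \<in> S\<close> by (meson openE subsetD)
    have "0 < min d e" using e \<open>0 < d\<close> by simp
    then obtain \<rho> y where \<rho>: "0 < \<rho>" "\<rho> < min d e" "ball y (c * \<rho>) \<subseteq> ball x \<rho>"
        "S \<inter> ball y (c * \<rho>) = {}"
      using por \<open>x \<in> S\<close> unfolding uniformly_porous_def by blast
    have "ball x \<rho> \<subseteq> V" using \<rho> e by (meson dual_order.trans less_imp_le min_less_iff_conj subset_ball)
    then have "(x, y, \<rho>) \<in> K" using \<rho> unfolding K_def by simp
    then show ?thesis using \<rho> by (intro exI[of _ "(x, y, \<rho>)"]) simp
  qed
  obtain I where I: "countable I" "I \<subseteq> K"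
     "pairwise (\<lambda>i j. disjnt (ball (fst i) (snd (snd i))) (ball (fst j) (snd (snd j)))) I"
     "negligible (S - (\<Union>i\<in>I. ball (fst i) (snd (snd i))))"
    by (rule Vitali_covering_theorem_balls[of S K fst "\<lambda>i. snd (snd i)", OF cover])
  define B where "B = (\<lambda>i::'a \<times> 'a \<times> real. ball (fst i) (snd (snd i)))"
  define R where "R = (\<lambda>i::'a \<times> 'a \<times> real. B i - ball (fst (snd i)) (c * snd (snd i)))"
  have B_in_V: "B i \<subseteq> V" and hole: "S \<inter> ball (fst (snd i)) (c * snd (snd i)) = {}" if "i \<in> I" for i
    using subsetD[OF I(2) that] unfolding K_def B_def by (auto simp: case_prod_unfold)
  have disjB: "disjoint_family_on B I"
    using I(3) unfolding pairwise_def disjoint_family_on_def disjnt_def B_def by blast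
  have disjR: "disjoint_family_on R I"
    using disjB unfolding disjoint_family_on_def R_def by blast
  have mB: "B i \<in> sets lebesgue" and mR: "R i \<in> sets lebesgue" for i
    unfolding B_def R_def by auto
  have "emeasure lebesgue (\<Union>(R ` I)) = (\<integral>\<^sup>+i. emeasure lebesgue (R i) \<partial>count_space I)"
    by (rule emeasure_UN_countable[OF mR I(1) disjR])
  also have "\<dots> = (\<integral>\<^sup>+i. ennreal ?q * emeasure lebesgue (B i) \<partial>count_space I)"
  proof (rule nn_integral_cong)
    fix i assume "i \<in> space (count_space I)"
    then have "i \<in> K" using I(2) by auto
    then show "emeasure lebesgue (R i) = ennreal ?q * emeasure lebesgue (B i)"
      unfolding K_def R_def B_def using emeasure_ball_minus_ball[OF c(1)] by auto
  qed
  also have "\<dots> = ennreal ?q * (\<integral>\<^sup>+i. emeasure lebesgue (B i) \<partial>count_space I)"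
    by (rule nn_integral_cmult) simp
  also have "(\<integral>\<^sup>+i. emeasure lebesgue (B i) \<partial>count_space I) = emeasure lebesgue (\<Union>(B ` I))"
    by (rule emeasure_UN_countable[OF mB I(1) disjB, symmetric])
  also have "\<dots> \<le> emeasure lebesgue V"
    using B_in_V V(2) by (intro emeasure_mono) auto
  finally have le: "emeasure lebesgue (\<Union>(R ` I)) \<le> ennreal ?q * emeasure lebesgue V"
    by (simp add: mult_left_mono)
  define N where "N = S - (\<Union>i\<in>I. B i)"
  have N: "N \<in> null_sets lebesgue"
    using I(4) unfolding N_def B_def by (simp add: negligible_iff_null_sets)
  have mRU: "\<Union>(R ` I) \<in> sets lebesgue"
    using I(1) mR by (intro sets.countable_UN') auto
  have em: "emeasure lebesgue (\<Union>(R ` I) \<union> N) \<le> ennreal (?q * measure lebesgue V)"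
    using le N mRU V(2) q
    by (simp add: emeasure_Un_null_set emeasure_eq_measure2 ennreal_mult'')
  have fm: "\<Union>(R ` I) \<union> N \<in> lmeasurable"
  proof (rule fmeasurableI)
    show "\<Union>(R ` I) \<union> N \<in> sets lebesgue" using mRU N by auto
    show "emeasure lebesgue (\<Union>(R ` I) \<union> N) < \<infinity>"
      using em by (simp add: order_le_less_trans)
  qed
  show thesis
  proof (rule that[OF fm])
    show "S \<subseteq> \<Union>(R ` I) \<union> N"
      using hole unfolding N_def R_def by fastforce
    show "measure lebesgue (\<Union>(R ` I) \<union> N) \<le> ?q * measure lebesgue V"
      using em fm q by (simp add: emeasure_eq_measure2)
  qed
qed

text \<open>The cover obtained after removing holes is no longer open; this lemma restores openness at arbitrarily
small cost, so that the shrinking step can be repeated.\<close>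

lemma lmeasurable_outer_open_less:
  assumes "W \<in> lmeasurable" "measure lebesgue W < m"
  obtains V where "open V" "V \<in> lmeasurable" "W \<subseteq> V" "measure lebesgue V < m"
proof -
  have W: "W \<in> sets lebesgue" using assms by blast
  obtain V where V: "open V" "W \<subseteq> V" "V - W \<in> lmeasurable"
      "emeasure lebesgue (V - W) < ennreal (m - measure lebesgue W)"
    using sets_lebesgue_outer_open[OF W, of "m - measure lebesgue W"] assms(2) by auto
  have Vm: "V \<in> lmeasurable"
    using V(1-3) assms(1) by (metis Diff_partition fmeasurable.Un)
  have "measure lebesgue (V - W) < m - measure lebesgue W"
    using V(3,4) assms(2) by (simp add: emeasure_eq_measure2 ennreal_less_iff)
  moreover have "measure lebesgue (V - W) = measure lebesgue V - measure lebesgue W"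
    using V(2) Vm assms(1) by (intro measurable_measure_Diff) auto
  ultimately show thesis using that V Vm by simp
qed

lemma uniformly_porous_subset:
  "uniformly_porous c S \<Longrightarrow> T \<subseteq> S \<Longrightarrow> uniformly_porous c T"
  unfolding uniformly_porous_def by (meson disjoint_iff subsetD)

text \<open>Shrinking an almost optimal open cover would beat the infimum of the measures of open covers, unless
this infimum is zero. Covers are used because an arbitrary porous set may fail to be measurable, and
the set is cut into bounded pieces because these have covers of finite measure.\<close>

lemma uniformly_porous_negligible:
  fixes S :: "'a::euclidean_space set"
  assumes por: "uniformly_porous c S" and c: "0 < c" "c < 1"
  shows "negligible S"
proof -
  let ?q = "1 - c ^ DIM('a)"
  have q: "0 \<le> ?q" "?q < 1" using c by (simp_all add: power_le_one)
  have "negligible (S \<inter> cbox a b)" for a b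
  proof -
    define T where "T = S \<inter> cbox a b"
    have porT: "uniformly_porous c T"
      using uniformly_porous_subset[OF por] unfolding T_def by blast
    define A where "A = {measure lebesgue V | V. open V \<and> V \<in> lmeasurable \<and> T \<subseteq> V}"
    define m where "m = Inf A"
    obtain V0 where "open V0" "V0 \<in> lmeasurable" "cbox a b \<subseteq> V0"
      by (rule lmeasurable_outer_open_less[of "cbox a b" "measure lebesgue (cbox a b) + 1"]) auto
    then have "A \<noteq> {}" unfolding A_def T_def by blast
    have bdd: "bdd_below A" unfolding A_def by (intro bdd_belowI[of _ 0]) auto
    have "m \<le> 0"
    proof (rule ccontr)
      assume "\<not> m \<le> 0"
      then obtain v where v: "v \<in> A" "?q * v < m"
      proof (cases "?q = 0")
        case False
        then have "m < m / ?q" using q \<open>\<not> m \<le> 0\<close> by (simp add: field_simps)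
        then obtain v where "v \<in> A" "v < m / ?q"
          using cInf_lessD[OF \<open>A \<noteq> {}\<close>] unfolding m_def by blast
        then show ?thesis using that False q by (simp add: field_simps)
      qed (use \<open>A \<noteq> {}\<close> in auto)
      then obtain V where V: "open V" "V \<in> lmeasurable" "T \<subseteq> V" "v = measure lebesgue V"
        unfolding A_def by blast
      obtain W where W: "W \<in> lmeasurable" "T \<subseteq> W" "measure lebesgue W \<le> ?q * measure lebesgue V"
        using uniformly_porous_shrink_cover[OF porT c V(1-3)] .
      then obtain V' where "open V'" "V' \<in> lmeasurable" "W \<subseteq> V'" "measure lebesgue V' < m"
        using lmeasurable_outer_open_less[OF W(1), of m] v V by force
      then have "measure lebesgue V' \<in> A" "measure lebesgue V' < m"
        using W(2) unfolding A_def by blast+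
      then show False using cInf_lower[OF _ bdd] unfolding m_def by force
    qed
    have "\<exists>V. T \<subseteq> V \<and> V \<in> lmeasurable \<and> measure lebesgue V < e" if "0 < e" for e
    proof -
      have "Inf A < e" using \<open>m \<le> 0\<close> that unfolding m_def by simp
      then show ?thesis using cInf_lessD[OF \<open>A \<noteq> {}\<close>] unfolding A_def by blast
    qed
    then show ?thesis unfolding T_def[symmetric] negligible_outer by blast
  qed
  then show ?thesis using negligible_on_intervals by blast
qed

section \<open>Differentiability almost everywhere from one-sided bounds\<close>

definition supergradient :: "('a::euclidean_space \<Rightarrow> real) \<Rightarrow> 'a \<Rightarrow> 'a \<Rightarrow> bool" where
  "supergradient f x p \<longleftrightarrow>
     (\<forall>e>0. \<exists>r>0. \<forall>y. norm (y - x) < r \<longrightarrow> f y \<le> f x + p \<bullet> (y - x) + e * norm (y - x))"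

text \<open>The linear part of a differentiable function that lies above \<open>f\<close> and touches it is represented by a
vector.\<close>

lemma supergradient_touching_above:
  fixes f g :: "'a::euclidean_space \<Rightarrow> real"
  assumes "(g has_derivative g') (at x)" "f x = g x" "\<And>y. f y \<le> g y"
  shows "\<exists>p. supergradient f x p"
proof -
  have lin: "linear g'" using assms(1) by (simp add: has_derivative_linear)
  define p where "p = (\<Sum>b\<in>Basis. g' b *\<^sub>R b)"
  have p: "g' h = p \<bullet> h" for h
  proof -
    have "g' h = g' (\<Sum>b\<in>Basis. (h \<bullet> b) *\<^sub>R b)" by (simp add: euclidean_representation)
    also have "\<dots> = p \<bullet> h"
      using lin
      by (simp add: p_def linear_sum linear_scale inner_sum_left)
        (simp add: inner_commute mult.commute)
    finally show ?thesis .
  qed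
  have "\<exists>r>0. \<forall>y. norm (y - x) < r \<longrightarrow> f y \<le> f x + p \<bullet> (y - x) + e * norm (y - x)" if e: "0 < e" for e
  proof -
    obtain r where r: "0 < r"
        "\<And>y. norm (y - x) < r \<Longrightarrow> norm (g y - g x - g' (y - x)) \<le> e * norm (y - x)"
      using conjunct2[OF assms(1)[unfolded has_derivative_at_alt], rule_format, OF e] by auto
    have "f y \<le> f x + p \<bullet> (y - x) + e * norm (y - x)" if "norm (y - x) < r" for y
      using r(2)[OF that] assms(2) assms(3)[of y] by (simp add: p abs_le_iff)
    then show ?thesis using r(1) by blast
  qed
  then show ?thesis unfolding supergradient_def by blast
qed

text \<open>The points at which \<open>q\<close> is a supergradient up to the error \<open>\<delta>\<close>, valid up to distance \<open>r\<close>, but at which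
\<open>f\<close> drops, arbitrarily close by, below the affine prediction by more than that error allows. The
factor \<open>4\<close> has to exceed \<open>2\<close>, because the upper bound is applied from a point of a ball that may be
twice as far from \<open>x\<close> as its centre; the rest pays for the variation of \<open>f\<close> and \<open>q\<close> on that ball.\<close>

definition falls_below_approx :: "('a::euclidean_space \<Rightarrow> real) \<Rightarrow> 'a \<Rightarrow> real \<Rightarrow> real \<Rightarrow> 'a set" where
  "falls_below_approx f q \<delta> r =
     {x. (\<forall>y. norm (y - x) < r \<longrightarrow> f y \<le> f x + q \<bullet> (y - x) + \<delta> * norm (y - x)) \<and>
         (\<forall>s>0. \<exists>y. norm (y - x) < s \<and> f y < f x + q \<bullet> (y - x) - 4 * \<delta> * norm (y - x))}"

text \<open>Let \<open>y\<close> be a point where \<open>f\<close> is more than \<open>4 * \<delta> * \<sigma>\<close> below its prediction from \<open>x\<close>, with \<open>\<sigma> = norm (y - x)\<close>. On the ball of radius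
\<open>k * \<sigma>\<close> around \<open>y\<close>, the values of \<open>f\<close> and the affine prediction change by at most \<open>\<delta> * \<sigma>\<close> together. If
this ball contained a point \<open>z\<close> of the set, the upper bound at \<open>z\<close>, with error at most
\<open>2 * \<delta> * \<sigma>\<close>, would force \<open>f x < f x\<close>.\<close>

lemma falls_below_approx_porous:
  fixes f :: "'a::euclidean_space \<Rightarrow> real"
  assumes lip: "L-lipschitz_on UNIV f" and \<delta>: "0 < \<delta>" and r: "0 < r"
  shows "\<exists>c. 0 < c \<and> c < 1 \<and> uniformly_porous c (falls_below_approx f q \<delta> r)"
proof -
  let ?S = "falls_below_approx f q \<delta> r"
  \<comment> \<open>The hole is small enough for the Lipschitz function \<open>f\<close> and the functional \<open>q\<close> to vary little on it.\<close>
  define k where "k = min 1 (\<delta> / (L + norm q + 1))"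
  have L: "0 \<le> L" using lip by (rule lipschitz_on_nonneg)
  have den: "0 < L + norm q + 1" using L by (simp add: add_nonneg_pos)
  have k: "0 < k" "k \<le> 1" "k * (L + norm q) \<le> \<delta>"
  proof -
    show "0 < k" "k \<le> 1" unfolding k_def using \<delta> den by auto
    have "k * (L + norm q) \<le> k * (L + norm q + 1)" using \<open>0 < k\<close> by simp
    also have "\<dots> \<le> \<delta> / (L + norm q + 1) * (L + norm q + 1)"
      using den by (intro mult_right_mono) (auto simp: k_def)
    finally show "k * (L + norm q) \<le> \<delta>" using den by simp
  qed
  have "\<exists>\<rho> y. 0 < \<rho> \<and> \<rho> < t \<and> ball y (k / 2 * \<rho>) \<subseteq> ball x \<rho> \<and> ?S \<inter> ball y (k / 2 * \<rho>) = {}"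
    if x: "x \<in> ?S" and t: "0 < t" for x t
  proof -
    have "0 < min t r / 2" using t r by simp
    then obtain y where y: "norm (y - x) < min t r / 2"
        "f y < f x + q \<bullet> (y - x) - 4 * \<delta> * norm (y - x)"
      using x unfolding falls_below_approx_def by blast
    define \<sigma> where "\<sigma> = norm (y - x)"
    have \<sigma>: "0 < \<sigma>" using y(2) unfolding \<sigma>_def by auto
    have near: "norm (z - x) < 2 * \<sigma>" if "z \<in> ball y (k * \<sigma>)" for z
    proof -
      have "norm (z - x) \<le> norm (z - y) + norm (y - x)"
        using norm_triangle_ineq[of "z - y" "y - x"] by simp
      also have "\<dots> < k * \<sigma> + \<sigma>" using that by (simp add: \<sigma>_def dist_norm norm_minus_commute)
      also have "\<dots> \<le> 2 * \<sigma>" using k \<sigma> mult_right_mono[of k 1 \<sigma>] by simp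
      finally show ?thesis .
    qed
    have "z \<notin> ?S" if z: "z \<in> ball y (k * \<sigma>)" for z
    proof
      assume "z \<in> ?S"
      have zx: "norm (x - z) < 2 * \<sigma>" using near[OF z] by (simp add: norm_minus_commute)
      also have "\<dots> < r" using y(1) unfolding \<sigma>_def by simp
      finally have "f x \<le> f z + q \<bullet> (x - z) + \<delta> * norm (x - z)"
        using \<open>z \<in> ?S\<close> unfolding falls_below_approx_def by blast
      moreover have "\<delta> * norm (x - z) \<le> \<delta> * (2 * \<sigma>)" using zx \<delta> by simp
      moreover have zy: "norm (z - y) \<le> k * \<sigma>" using z by (simp add: dist_norm norm_minus_commute)
      have "f z \<le> f y + L * (k * \<sigma>)"
        using lipschitz_onD[OF lip, of z y] mult_left_mono[OF zy L]
        by (simp add: dist_norm abs_le_iff)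
      moreover have "q \<bullet> (y - z) \<le> norm q * (k * \<sigma>)"
        using norm_cauchy_schwarz[of q "y - z"] mult_left_mono[OF zy norm_ge_zero[of q]]
        by (simp add: norm_minus_commute)
      moreover have "q \<bullet> (y - x) + q \<bullet> (x - z) = q \<bullet> (y - z)" by (simp add: inner_diff_right)
      moreover have "L * (k * \<sigma>) + norm q * (k * \<sigma>) \<le> \<delta> * \<sigma>"
        using mult_right_mono[OF k(3), of \<sigma>] \<sigma> by (simp add: algebra_simps)
      moreover have "0 < \<delta> * \<sigma>" using \<delta> \<sigma> by simp
      ultimately show False using y(2) unfolding \<sigma>_def[symmetric] by argo
    qed
    then have "ball y (k * \<sigma>) \<inter> ?S = {}" by blast
    moreover have "ball y (k * \<sigma>) \<subseteq> ball x (2 * \<sigma>)"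
      using near by (auto simp: dist_norm norm_minus_commute)
    ultimately show ?thesis
      using \<sigma> y(1) by (intro exI[of _ "2 * \<sigma>"] exI[of _ y]) (auto simp: \<sigma>_def)
  qed
  then have "uniformly_porous (k / 2) ?S" unfolding uniformly_porous_def by blast
  then show ?thesis using k by (intro exI[of _ "k / 2"]) auto
qed

text \<open>A supergradient \<open>p\<close> that is not the derivative is violated from below with some slope \<open>e\<close>. It is enough to
choose \<open>\<delta> < e / 5\<close> and \<open>q\<close> within \<open>\<delta> / 2\<close> of \<open>p\<close>: replacing \<open>p\<close> by \<open>q\<close> then costs
less than the margin between \<open>e\<close> and \<open>4 * \<delta>\<close>.\<close>

lemma superdifferentiable_in_falls_below_approx:
  fixes f :: "'a::euclidean_space \<Rightarrow> real"
  assumes D: "\<And>X::'a set. open X \<Longrightarrow> X \<noteq> {} \<Longrightarrow> \<exists>d\<in>D. d \<in> X"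
    and p: "supergradient f x p" and nd: "\<not> f differentiable (at x)"
  shows "\<exists>q\<in>D. \<exists>m n. x \<in> falls_below_approx f q (1 / real (Suc m)) (1 / real (Suc n))"
proof -
  have "\<not> (f has_derivative (\<lambda>h. p \<bullet> h)) (at x)"
    using nd unfolding differentiable_def by blast
  then obtain e where e: "0 < e"
      "\<And>s. 0 < s \<Longrightarrow> \<exists>y. norm (y - x) < s \<and> \<not> norm (f y - f x - p \<bullet> (y - x)) \<le> e * norm (y - x)"
    unfolding has_derivative_at_alt using bounded_linear_inner_right by blast
  obtain m where m: "1 / real (Suc m) < e / 5"
    using nat_approx_posE[of "e / 5"] e(1) by (auto simp: field_simps)
  define \<delta> where "\<delta> = 1 / real (Suc m)"
  have \<delta>: "0 < \<delta>" "5 * \<delta> < e" using m unfolding \<delta>_def by auto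
  have "ball p (\<delta> / 2) \<noteq> {}" using \<delta> by simp
  then obtain q where q: "q \<in> D" "q \<in> ball p (\<delta> / 2)"
    using D[OF open_ball] by blast
  have qp: "\<bar>q \<bullet> h - p \<bullet> h\<bar> \<le> \<delta> / 2 * norm h" for h
  proof -
    have "\<bar>q \<bullet> h - p \<bullet> h\<bar> \<le> norm (q - p) * norm h"
      using Cauchy_Schwarz_ineq2[of "q - p" h] by (simp add: inner_diff_left)
    also have "\<dots> \<le> \<delta> / 2 * norm h"
      using q(2) by (intro mult_right_mono) (auto simp: dist_norm norm_minus_commute)
    finally show ?thesis .
  qed
  have pq: "p \<bullet> h \<le> q \<bullet> h + \<delta> / 2 * norm h" "q \<bullet> h \<le> p \<bullet> h + \<delta> / 2 * norm h" for h
    using abs_le_D1[OF qp[of h]] abs_le_D2[OF qp[of h]] by linarith+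
  obtain r where r: "0 < r"
      "\<And>y. norm (y - x) < r \<Longrightarrow> f y \<le> f x + p \<bullet> (y - x) + \<delta> / 2 * norm (y - x)"
    using p \<delta> unfolding supergradient_def by (meson half_gt_zero)
  obtain n where n: "1 / real (Suc n) < r"
    using nat_approx_posE[OF r(1)] by (auto simp: field_simps)
  have "f y \<le> f x + q \<bullet> (y - x) + \<delta> * norm (y - x)" if "norm (y - x) < 1 / real (Suc n)" for y
    using r(2)[of y] that n pq(1)[of "y - x"] by simp
  moreover have "\<exists>y. norm (y - x) < s \<and> f y < f x + q \<bullet> (y - x) - 4 * \<delta> * norm (y - x)"
    if s: "0 < s" for s
  proof -
    have "0 < min s r" using s r by simp
    then obtain y where y: "norm (y - x) < min s r"
        "\<not> norm (f y - f x - p \<bullet> (y - x)) \<le> e * norm (y - x)"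
      using e(2) by blast
    have ne: "0 < norm (y - x)" using y(2) by auto
    have "\<delta> / 2 * norm (y - x) \<le> e * norm (y - x)" using \<delta> by (intro mult_right_mono) auto
    then have "f y < f x + p \<bullet> (y - x) - e * norm (y - x)"
      using r(2)[of y] y by (auto simp: abs_le_iff)
    moreover have "5 * \<delta> * norm (y - x) < e * norm (y - x)"
      using \<delta> ne by (intro mult_strict_right_mono) auto
    moreover have "0 < \<delta> * norm (y - x)" using \<delta> ne by simp
    ultimately have "f y < f x + q \<bullet> (y - x) - 4 * \<delta> * norm (y - x)"
      using pq(1)[of "y - x"] by simp
    then show ?thesis using y(1) by auto
  qed
  ultimately have "x \<in> falls_below_approx f q \<delta> (1 / real (Suc n))"
    unfolding falls_below_approx_def by blast
  then show ?thesis using q(1) unfolding \<delta>_def by blast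
qed

theorem lipschitz_superdifferentiable_imp_differentiable_ae:
  fixes f :: "'a::euclidean_space \<Rightarrow> real"
  assumes lip: "L-lipschitz_on UNIV f"
  shows "negligible {x. (\<exists>p. supergradient f x p) \<and> \<not> f differentiable (at x)}"
proof -
  obtain D :: "'a set" where D: "countable D"
      "\<And>X. open X \<Longrightarrow> X \<noteq> {} \<Longrightarrow> \<exists>d\<in>D. d \<in> X"
    using countable_dense_setE by blast
  define F where "F = (\<lambda>(q, m, n). falls_below_approx f q (1 / real (Suc m)) (1 / real (Suc n)))"
  have "negligible (\<Union>(F ` (D \<times> UNIV \<times> UNIV)))"
  proof (rule negligible_countable_Union)
    show "countable (F ` (D \<times> UNIV \<times> UNIV))" using D(1) by auto
    fix S assume "S \<in> F ` (D \<times> UNIV \<times> UNIV)"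
    then obtain q m n where S: "S = falls_below_approx f q (1 / real (Suc m)) (1 / real (Suc n))"
      unfolding F_def by auto
    show "negligible S"
      using falls_below_approx_porous[OF lip, of "1 / real (Suc m)" "1 / real (Suc n)" q]
        uniformly_porous_negligible unfolding S by auto
  qed
  moreover have "{x. (\<exists>p. supergradient f x p) \<and> \<not> f differentiable (at x)} \<subseteq> \<Union>(F ` (D \<times> UNIV \<times> UNIV))"
    using superdifferentiable_in_falls_below_approx[OF D(2)] unfolding F_def by fastforce
  ultimately show ?thesis using negligible_subset by blast
qed

text \<open>At each point it may be either \<open>f\<close> or \<open>- f\<close> that has a supergradient; the two kinds of points are
treated separately.\<close>

corollary lipschitz_semidifferentiable_imp_differentiable_ae:
  fixes f :: "'a::euclidean_space \<Rightarrow> real"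
  assumes lip: "L-lipschitz_on UNIV f"
    and semi: "\<And>x. (\<exists>p. supergradient f x p) \<or> (\<exists>p. supergradient (\<lambda>y. - f y) x p)"
  shows "negligible {x. \<not> f differentiable (at x)}"
proof -
  have "L-lipschitz_on UNIV (\<lambda>y. - f y)" using lip by (simp add: lipschitz_on_def dist_norm norm_minus_commute)
  then have *: "negligible ({x. (\<exists>p. supergradient f x p) \<and> \<not> f differentiable (at x)} \<union>
      {x. (\<exists>p. supergradient (\<lambda>y. - f y) x p) \<and> \<not> (\<lambda>y. - f y) differentiable (at x)})"
    by (intro negligible_Un lipschitz_superdifferentiable_imp_differentiable_ae[OF lip]
        lipschitz_superdifferentiable_imp_differentiable_ae[of L])
  moreover have "(\<lambda>y. - f y) differentiable (at x) \<longleftrightarrow> f differentiable (at x)" for x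
    using differentiable_minus[of "\<lambda>y. - f y" "at x"] differentiable_minus[of f "at x"] by auto
  ultimately show ?thesis using semi by (intro negligible_subset[OF *]) auto
qed

section \<open>Lebesgue measure on a subspace\<close>

text \<open>Lebesgue measure on the span of \<open>B\<close> is a product indexed by \<open>B\<close>, while Lebesgue measure on the
whole space is a product indexed by the standard basis. This renaming of the index set relates the two.\<close>

lemma distr_PiM_reindex_bij:
  assumes "sigma_finite_measure M" and J: "finite J" and bij: "bij_betw \<pi> I J"
  shows "distr (\<Pi>\<^sub>M j\<in>J. M) (\<Pi>\<^sub>M i\<in>I. M) (\<lambda>f. \<lambda>i\<in>I. f (\<pi> i)) = (\<Pi>\<^sub>M i\<in>I. M)"
proof -
  interpret sigma_finite_measure M by fact
  interpret product_sigma_finite "\<lambda>_. M" by standard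
  have I: "finite I" using J bij bij_betw_finite by blast
  have \<pi>J: "\<pi> i \<in> J" if "i \<in> I" for i using bij that bij_betwE by blast
  have meas: "(\<lambda>f. \<lambda>i\<in>I. f (\<pi> i)) \<in> measurable (\<Pi>\<^sub>M j\<in>J. M) (\<Pi>\<^sub>M i\<in>I. M)"
    by (intro measurable_restrict measurable_component_singleton) (rule \<pi>J)
  show ?thesis
  proof (rule PiM_eqI[OF I])
    fix A assume A: "\<And>i. i \<in> I \<Longrightarrow> A i \<in> sets M"
    define A' where "A' j = A (inv_into I \<pi> j)" for j
    have A'\<pi>: "A' (\<pi> i) = A i" if "i \<in> I" for i
      using that bij unfolding A'_def by (simp add: bij_betw_inv_into_left)
    have A'J: "A' j \<in> sets M" if "j \<in> J" for j
      unfolding A'_def using bij_betwE[OF bij_betw_inv_into[OF bij]] that A by simp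
    have "(\<lambda>f. \<lambda>i\<in>I. f (\<pi> i)) -` (Pi\<^sub>E I A) \<inter> space (\<Pi>\<^sub>M j\<in>J. M) = Pi\<^sub>E J A'"
    proof -
      have "(\<forall>i\<in>I. f (\<pi> i) \<in> A i) \<longleftrightarrow> (\<forall>j\<in>J. f j \<in> A' j)" for f
        using bij_betw_imp_surj_on[OF bij, symmetric] A'\<pi> by simp
      moreover have "v \<in> space M" if "j \<in> J" "v \<in> A' j" for j v
        using sets.sets_into_space[OF A'J[OF that(1)]] that(2) by blast
      ultimately show ?thesis
        by (auto simp: space_PiM PiE_iff)
    qed
    then have "emeasure (distr (\<Pi>\<^sub>M j\<in>J. M) (\<Pi>\<^sub>M i\<in>I. M) (\<lambda>f. \<lambda>i\<in>I. f (\<pi> i))) (Pi\<^sub>E I A)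
        = emeasure (\<Pi>\<^sub>M j\<in>J. M) (Pi\<^sub>E J A')"
      using A I by (subst emeasure_distr[OF meas]) (auto intro!: sets_PiM_I_finite)
    also have "\<dots> = (\<Prod>j\<in>J. emeasure M (A' j))"
      using A'J J by (intro emeasure_PiM) auto
    also have "\<dots> = (\<Prod>i\<in>I. emeasure M (A' (\<pi> i)))"
      by (rule prod.reindex_bij_betw[OF bij, symmetric])
    also have "\<dots> = (\<Prod>i\<in>I. emeasure M (A i))"
      using A'\<pi> by simp
    finally show "emeasure (distr (\<Pi>\<^sub>M j\<in>J. M) (\<Pi>\<^sub>M i\<in>I. M) (\<lambda>f. \<lambda>i\<in>I. f (\<pi> i))) (Pi\<^sub>E I A)
        = (\<Prod>i\<in>I. emeasure M (A i))" .
  qed simp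
qed

text \<open>An orthonormal set \<open>B\<close> together with a set \<open>I\<close> of standard basis vectors that serves as its index set. The
point is that \<open>Basis - I\<close> provides complementary coordinates, so that the measure of the whole space
factors into that of the span of \<open>B\<close> and another one.\<close>

locale orthonormal_frame =
  fixes B :: "'a::euclidean_space set" and I :: "'a set" and \<pi> :: "'a \<Rightarrow> 'a"
  assumes orth: "pairwise orthogonal B" and unit: "\<And>b. b \<in> B \<Longrightarrow> norm b = 1"
    and I_Basis: "I \<subseteq> Basis" and bij: "bij_betw \<pi> I B"
begin

definition to_span :: "'a \<Rightarrow> 'a" where
  "to_span z = (\<Sum>i\<in>I. (z \<bullet> i) *\<^sub>R \<pi> i)"

definition from_span :: "'a \<Rightarrow> 'a" where
  "from_span u = (\<Sum>i\<in>I. (u \<bullet> \<pi> i) *\<^sub>R i)"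

lemma finite_I: "finite I" and finite_B: "finite B"
proof -
  show "finite I" using I_Basis finite_subset finite_Basis by blast
  then show "finite B" using bij bij_betw_finite by blast
qed

lemma \<pi>_in: "i \<in> I \<Longrightarrow> \<pi> i \<in> B"
  using bij bij_betwE by blast

lemma bounded_linear_to_span: "bounded_linear to_span"
  unfolding to_span_def
  by (intro bounded_linear_sum bounded_linear_scaleR_const bounded_linear_inner_left)

lemma bounded_linear_from_span: "bounded_linear from_span"
  unfolding from_span_def
  by (intro bounded_linear_sum bounded_linear_scaleR_const bounded_linear_inner_left)

lemma to_span_in: "to_span z \<in> span B"
  unfolding to_span_def by (intro span_sum span_scale span_base \<pi>_in)

lemma inner_I: "i \<in> I \<Longrightarrow> j \<in> I \<Longrightarrow> i \<bullet> j = (if i = j then 1 else 0)"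
  using I_Basis inner_Basis by blast

lemma to_span_from_span:
  assumes "u \<in> span B"
  shows "to_span (from_span u) = u"
proof -
  have "from_span u \<bullet> j = u \<bullet> \<pi> j" if "j \<in> I" for j
  proof -
    have "from_span u \<bullet> j = (\<Sum>i\<in>I. if i = j then u \<bullet> \<pi> i else 0)"
      unfolding from_span_def inner_sum_left using inner_I that by (intro sum.cong) auto
    then show ?thesis using finite_I that by simp
  qed
  then have "to_span (from_span u) = (\<Sum>i\<in>I. (u \<bullet> \<pi> i) *\<^sub>R \<pi> i)"
    unfolding to_span_def by simp
  also have "\<dots> = (\<Sum>b\<in>B. (u \<bullet> b) *\<^sub>R b)"
    by (rule sum.reindex_bij_betw[OF bij])
  also have "\<dots> = u"
    using orthonormal_basis_expand[OF orth unit assms finite_B] by simp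
  finally show ?thesis .
qed

lemma from_span_coordinates:
  "from_span (\<Sum>b\<in>B. h b *\<^sub>R b) = (\<Sum>i\<in>I. h (\<pi> i) *\<^sub>R i)"
proof -
  have "(\<Sum>b\<in>B. h b *\<^sub>R b) \<bullet> c = h c" if "c \<in> B" for c
  proof -
    have "b \<bullet> c = (if b = c then 1 else 0)" if "b \<in> B" for b
      using orth unit \<open>c \<in> B\<close> that unfolding pairwise_def orthogonal_def
      by (auto simp: norm_eq_1)
    then have "(\<Sum>b\<in>B. h b *\<^sub>R b) \<bullet> c = (\<Sum>b\<in>B. if b = c then h b else 0)"
      unfolding inner_sum_left by (intro sum.cong) auto
    then show ?thesis using finite_B that by simp
  qed
  then show ?thesis unfolding from_span_def using \<pi>_in by simp
qed

lemma to_span_complement: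
  assumes "w = (\<Sum>i\<in>Basis - I. g i *\<^sub>R i)"
  shows "to_span w = 0"
proof -
  have "w \<bullet> j = 0" if "j \<in> I" for j
  proof -
    have "j \<in> Basis" using that I_Basis by blast
    then show ?thesis
      unfolding assms inner_sum_left using that
      by (intro sum.neutral) (auto simp: inner_Basis)
  qed
  then show ?thesis unfolding to_span_def by simp
qed

text \<open>By Fubini's theorem there is a choice of the coordinates outside \<open>I\<close>, a vector \<open>w\<close>, such that the slice at
\<open>w\<close> of the exceptional null set is null. Since \<open>to_span\<close> ignores \<open>w\<close>, this slice contains all exceptional
points of the span.\<close>

lemma AE_lborel_spanI:
  assumes "negligible {z. \<not> P (to_span z)}"
  shows "AE x in lborel_span B. P x"
proof -
  interpret product_sigma_finite "\<lambda>_::'a. lborel :: real measure"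
    by standard
  define J where "J = Basis - I"
  have J: "finite J" "J \<inter> I = {}" "J \<union> I = Basis" using I_Basis unfolding J_def by auto
  interpret JI: pair_sigma_finite "\<Pi>\<^sub>M b\<in>J. lborel :: real measure" "\<Pi>\<^sub>M b\<in>I. lborel :: real measure"
    by (intro pair_sigma_finite.intro sigma_finite J(1) finite_I)
  \<comment> \<open>Null sets of the completed and of the Borel measure differ, and only Borel sets can be pushed forward below.\<close>
  obtain N where N: "N \<in> null_sets lborel" "{z. \<not> P (to_span z)} \<subseteq> N"
    using assms unfolding negligible_iff_null_sets null_sets_completion_iff2 by blast
  have Nb: "N \<in> sets borel" using N(1) by auto
  have "AE z in distr (\<Pi>\<^sub>M b\<in>Basis. lborel) borel (\<lambda>f. \<Sum>b\<in>Basis. f b *\<^sub>R b). z \<notin> N"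
    by (subst lborel_eq[symmetric]) (rule AE_not_in[OF N(1)])
  then have "AE f in (\<Pi>\<^sub>M b\<in>Basis. lborel). (\<Sum>b\<in>Basis. f b *\<^sub>R b) \<notin> N"
    by (rule AE_distrD[rotated]) measurable
  then have "AE f in distr ((\<Pi>\<^sub>M b\<in>J. lborel) \<Otimes>\<^sub>M (\<Pi>\<^sub>M b\<in>I. lborel)) (\<Pi>\<^sub>M b\<in>J \<union> I. lborel) (merge J I).
      (\<Sum>b\<in>Basis. f b *\<^sub>R b) \<notin> N"
    by (subst distr_merge[OF J(2) J(1) finite_I]) (simp only: J(3))
  then have "AE h in ((\<Pi>\<^sub>M b\<in>J. lborel) \<Otimes>\<^sub>M (\<Pi>\<^sub>M b\<in>I. lborel)).
      (\<Sum>b\<in>Basis. merge J I h b *\<^sub>R b) \<notin> N"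
    by (rule AE_distrD[OF measurable_merge])
  from JI.AE_pair[OF this] have ae: "AE g in (\<Pi>\<^sub>M b\<in>J. lborel). AE f in (\<Pi>\<^sub>M b\<in>I. lborel).
      (\<Sum>b\<in>Basis. merge J I (g, f) b *\<^sub>R b) \<notin> N" .
  have "emeasure (\<Pi>\<^sub>M b\<in>J. lborel :: real measure) (space (\<Pi>\<^sub>M b\<in>J. lborel)) \<noteq> 0"
    using J(1) by (simp add: space_PiM emeasure_PiM prod_zero_iff)
  then have "ae_filter (\<Pi>\<^sub>M b\<in>J. lborel :: real measure) \<noteq> bot"
    by (simp only: ae_filter_eq_bot_iff) simp
  from eventually_happens'[OF this ae] obtain g where
    g: "AE f in (\<Pi>\<^sub>M b\<in>I. lborel). (\<Sum>b\<in>Basis. merge J I (g, f) b *\<^sub>R b) \<notin> N" ..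
  define w where "w = (\<Sum>i\<in>J. g i *\<^sub>R i)"
  have "(\<Sum>b\<in>Basis. merge J I (g, f) b *\<^sub>R b) = w + (\<Sum>i\<in>I. f i *\<^sub>R i)" for f
  proof -
    have "(\<Sum>b\<in>J \<union> I. merge J I (g, f) b *\<^sub>R b)
        = (\<Sum>b\<in>J. merge J I (g, f) b *\<^sub>R b) + (\<Sum>b\<in>I. merge J I (g, f) b *\<^sub>R b)"
      by (rule sum.union_disjoint[OF J(1) finite_I J(2)])
    then show ?thesis using J(2,3) unfolding w_def by (auto simp: merge_def intro!: sum.cong)
  qed
  with g have "AE f in (\<Pi>\<^sub>M b\<in>I. lborel). w + (\<Sum>i\<in>I. f i *\<^sub>R i) \<notin> N"
    by simp
  then have "AE h in (\<Pi>\<^sub>M b\<in>B. lborel). w + (\<Sum>i\<in>I. (\<lambda>i\<in>I. h (\<pi> i)) i *\<^sub>R i) \<notin> N"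
    by (subst (asm) distr_PiM_reindex_bij[OF lborel.sigma_finite_measure_axioms finite_B bij, symmetric])
      (erule AE_distrD[rotated], intro measurable_restrict measurable_component_singleton \<pi>_in)
  then have ae_B: "AE h in (\<Pi>\<^sub>M b\<in>B. lborel). w + from_span (\<Sum>b\<in>B. h b *\<^sub>R b) \<notin> N"
    by (simp add: from_span_coordinates cong: sum.cong)
  have meas: "{u \<in> space (restrict_space borel (span B)). w + from_span u \<notin> N}
      \<in> sets (restrict_space borel (span B))"
  proof -
    have "(\<lambda>u. w + from_span u) \<in> borel_measurable (restrict_space borel (span B))"
      by (intro measurable_restrict_space1 borel_measurable_continuous_onI continuous_intros
          linear_continuous_on bounded_linear_from_span)
    from measurable_sets[OF this, of "- N"] show ?thesis
      using Nb by (simp add: vimage_def Int_def conj_commute)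
  qed
  have "AE u in lborel_span B. w + from_span u \<notin> N"
    unfolding lborel_span_def by (rule iffD2[OF AE_distr_iff[OF lborel_span_measurable meas] ae_B])
  then show ?thesis
  proof (rule AE_mp, intro AE_I2 impI)
    fix u assume "u \<in> space (lborel_span B)" "w + from_span u \<notin> N"
    then have "u \<in> span B" "P (to_span (w + from_span u))"
      using N(2) unfolding lborel_span_def by (auto simp: space_restrict_space)
    moreover have "to_span (w + from_span u) = to_span w + to_span (from_span u)"
      using bounded_linear_to_span by (simp add: linear_simps)
    ultimately show "P u"
      using to_span_from_span to_span_complement[OF w_def[unfolded J_def]] by simp
  qed
qed

text \<open>Through any \<open>z\<close> there is an affine right inverse \<open>\<sigma>\<close> of \<open>to_span\<close>, and composing with it recovers \<open>F\<close> on the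
span from \<open>F \<circ> to_span\<close>.\<close>

lemma AE_lborel_span_differentiable:
  fixes F :: "'a \<Rightarrow> real"
  assumes "negligible {z. \<not> (\<lambda>z. F (to_span z)) differentiable (at z)}"
  shows "AE x in lborel_span B. F differentiable (at x within span B)"
proof (rule AE_lborel_spanI, rule negligible_subset[OF assms], safe)
  fix z
  assume G: "(\<lambda>z. F (to_span z)) differentiable (at z)"
    and nd: "\<not> F differentiable (at (to_span z) within span B)"
  define \<sigma> where "\<sigma> u = z + from_span (u - to_span z)" for u
  have \<sigma>z: "\<sigma> (to_span z) = z"
    unfolding \<sigma>_def using bounded_linear_from_span by (simp add: linear_simps)
  have "(\<sigma> has_derivative from_span) (at (to_span z) within span B)"
    unfolding \<sigma>_def
    by (auto intro!: derivative_eq_intros bounded_linear.has_derivative[OF bounded_linear_from_span])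
  then have "\<sigma> differentiable (at (to_span z) within span B)"
    unfolding differentiable_def by blast
  then have "(\<lambda>u. F (to_span (\<sigma> u))) differentiable (at (to_span z) within span B)"
    by (intro differentiable_compose[of "\<lambda>z. F (to_span z)" \<sigma>]) (simp_all add: \<sigma>z G)
  then obtain D where D: "((\<lambda>u. F (to_span (\<sigma> u))) has_derivative D) (at (to_span z) within span B)"
    unfolding differentiable_def by blast
  have F_eq: "F u = F (to_span (\<sigma> u))" if "u \<in> span B" for u
  proof -
    have "u - to_span z \<in> span B" by (intro span_diff that to_span_in)
    then have "to_span (\<sigma> u) = u"
      unfolding \<sigma>_def using bounded_linear_to_span to_span_from_span by (simp add: linear_simps)
    then show ?thesis by simp
  qed
  have "(F has_derivative D) (at (to_span z) within span B)"
    by (rule has_derivative_transform[OF to_span_in F_eq D])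
  with nd show False unfolding differentiable_def by blast
qed

end

lemma orthonormal_frame_exists:
  fixes B :: "'a::euclidean_space set"
  assumes "orthonormal_basis_of B U"
  obtains I \<pi> where "orthonormal_frame B I \<pi>"
proof -
  have B: "pairwise orthogonal B" "\<And>b. b \<in> B \<Longrightarrow> norm b = 1"
    using assms unfolding orthonormal_basis_of_def by auto
  then have "independent B" using B(2)[of 0] by (intro pairwise_orthogonal_independent) auto
  then have fin: "finite B" and card: "card B \<le> card (Basis :: 'a set)"
    using independent_bound by auto
  obtain I where I: "I \<subseteq> (Basis :: 'a set)" "card I = card B" "finite I"
    using obtain_subset_with_card_n[OF card] by blast
  obtain \<pi> where "bij_betw \<pi> I B"
    using finite_same_card_bij[OF I(3) fin I(2)] by blast
  with B I(1) have "orthonormal_frame B I \<pi>" unfolding orthonormal_frame_def by simp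
  then show thesis by (rule that)
qed

section \<open>The distance function of a norm\<close>

lemma is_normD:
  assumes "is_norm \<nu>"
  shows is_norm_nonneg: "0 \<le> \<nu> x" and is_norm_eq_0: "\<nu> x = 0 \<longleftrightarrow> x = 0"
    and is_norm_scale: "\<nu> (a *\<^sub>R x) = \<bar>a\<bar> * \<nu> x" and is_norm_triangle: "\<nu> (x + y) \<le> \<nu> x + \<nu> y"
  using assms unfolding is_norm_def by blast+

lemma is_norm_upper_bound:
  fixes \<nu> :: "'a::euclidean_space \<Rightarrow> real"
  assumes "is_norm \<nu>"
  shows "\<exists>K\<ge>0. \<forall>x. \<nu> x \<le> K * norm x"
proof -
  have "sphere (0::'a) 1 \<noteq> {}" by simp
  then obtain z :: 'a where "norm z = 1" and z: "\<And>x. norm x = 1 \<Longrightarrow> \<nu> x \<le> \<nu> z"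
    using continuous_attains_sup[OF compact_sphere _ is_norm_continuous[OF assms], of 0 1] by auto
  have "\<nu> x \<le> \<nu> z * norm x" for x
  proof (cases "x = 0")
    case True
    then show ?thesis using is_norm_eq_0[OF assms, of x] by simp
  next
    case False
    have "\<nu> ((1 / norm x) *\<^sub>R x) \<le> \<nu> z"
      by (rule z) (use False in simp)
    then show ?thesis using False is_norm_scale[OF assms, of "1 / norm x" x] by (simp add: field_simps)
  qed
  then show ?thesis using is_norm_nonneg[OF assms] by blast
qed

lemma dist_nu_le:
  fixes \<nu> :: "'a::euclidean_space \<Rightarrow> real"
  assumes "is_norm \<nu>" "y \<in> C"
  shows "dist_nu \<nu> C x \<le> \<nu> (x - y)"
  unfolding dist_nu_def using assms
  by (intro cINF_lower bdd_belowI[of _ 0]) (auto simp: is_norm_nonneg)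

lemma dist_nu_diff_le:
  fixes \<nu> :: "'a::euclidean_space \<Rightarrow> real"
  assumes \<nu>: "is_norm \<nu>" and C: "closed C" "C \<noteq> {}"
  shows "dist_nu \<nu> C x - dist_nu \<nu> C z \<le> \<nu> (x - z)"
proof -
  obtain y where y: "y \<in> C" "\<nu> (z - y) = dist_nu \<nu> C z"
    using best_approx_exists[OF \<nu> C, of z] unfolding best_approx_def by blast
  have "dist_nu \<nu> C x \<le> \<nu> ((x - z) + (z - y))"
    using dist_nu_le[OF \<nu> y(1)] by simp
  also have "\<dots> \<le> \<nu> (x - z) + dist_nu \<nu> C z"
    using is_norm_triangle[OF \<nu>] y(2) by metis
  finally show ?thesis by simp
qed

lemma dist_nu_abs_diff_le:
  fixes \<nu> :: "'a::euclidean_space \<Rightarrow> real"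
  assumes \<nu>: "is_norm \<nu>" and C: "closed C" "C \<noteq> {}"
  shows "\<bar>dist_nu \<nu> C x - dist_nu \<nu> C z\<bar> \<le> \<nu> (x - z)"
  using dist_nu_diff_le[OF assms, of x z] dist_nu_diff_le[OF assms, of z x]
    is_norm_minus[OF \<nu>, of "x - z"] by simp

lemma dist_nu_lipschitz:
  fixes \<nu> :: "'a::euclidean_space \<Rightarrow> real"
  assumes \<nu>: "is_norm \<nu>" and C: "closed C" "C \<noteq> {}"
  shows "\<exists>L. L-lipschitz_on UNIV (dist_nu \<nu> C)"
proof -
  obtain K where K: "0 \<le> K" "\<And>x. \<nu> x \<le> K * norm x"
    using is_norm_upper_bound[OF \<nu>] by blast
  have "\<bar>dist_nu \<nu> C x - dist_nu \<nu> C z\<bar> \<le> K * norm (x - z)" for x z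
    using dist_nu_abs_diff_le[OF assms] K(2) by (rule order_trans)
  then have "K-lipschitz_on UNIV (dist_nu \<nu> C)"
    using K(1) by (intro lipschitz_onI) (auto simp: dist_norm)
  then show ?thesis by blast
qed

lemma dist_nu_nonneg:
  fixes \<nu> :: "'a::euclidean_space \<Rightarrow> real"
  assumes "is_norm \<nu>" "C \<noteq> {}"
  shows "0 \<le> dist_nu \<nu> C x"
  unfolding dist_nu_def using assms by (intro cINF_greatest) (auto simp: is_norm_nonneg)

lemma best_approx_in_set:
  fixes \<nu> :: "'a::euclidean_space \<Rightarrow> real"
  assumes \<nu>: "is_norm \<nu>" and x: "x \<in> C"
  shows "dist_nu \<nu> C x = 0" and "best_approx \<nu> C x y \<longleftrightarrow> y = x"
proof -
  have "0 \<le> dist_nu \<nu> C x"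
    using x by (intro dist_nu_nonneg[OF \<nu>]) auto
  moreover have "\<nu> (x - x) = 0" using is_norm_eq_0[OF \<nu>] by simp
  ultimately show "dist_nu \<nu> C x = 0" using dist_nu_le[OF \<nu> x, of x] by simp
  then show "best_approx \<nu> C x y \<longleftrightarrow> y = x"
    unfolding best_approx_def using is_norm_eq_0[OF \<nu>, of "x - y"] x by auto
qed

lemma differentiable_norm_has_derivative:
  assumes "differentiable_norm \<nu>" "v \<noteq> 0"
  shows "(\<nu> has_derivative frechet_derivative \<nu> (at v)) (at v)"
proof -
  have "\<nu> differentiable (at v within UNIV - {0})"
    using assms unfolding differentiable_norm_def differentiable_on_def by blast
  moreover have "at v within UNIV - {0} = at v"
    using assms(2) by (intro at_within_open) (auto simp: open_delete)
  ultimately show ?thesis using frechet_derivative_works by metis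
qed

text \<open>Outside \<open>C\<close> the distance to a single best approximation touches from above; on \<open>C\<close> the constant \<open>0\<close>
touches from below. Precomposition with \<open>A\<close> preserves both.\<close>

lemma negligible_dist_nu_not_differentiable:
  fixes \<nu> :: "'a::euclidean_space \<Rightarrow> real" and A :: "'b::euclidean_space \<Rightarrow> 'a"
  assumes \<nu>: "is_norm \<nu>" and diff: "differentiable_norm \<nu>" and C: "closed C" "C \<noteq> {}"
    and A: "bounded_linear A"
  shows "negligible {z. \<not> (\<lambda>z. dist_nu \<nu> C (A z)) differentiable (at z)}"
proof -
  obtain L where L: "L-lipschitz_on UNIV (dist_nu \<nu> C)"
    using dist_nu_lipschitz[OF \<nu> C] by blast
  obtain M where M: "M-lipschitz_on UNIV A"
    using bounded_linear.lipschitz_boundE[OF A] by blast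
  have "(L * M)-lipschitz_on UNIV (\<lambda>z. dist_nu \<nu> C (A z))"
    by (rule lipschitz_on_compose2[OF M lipschitz_on_subset[OF L subset_UNIV]])
  moreover have "(\<exists>p. supergradient (\<lambda>z. dist_nu \<nu> C (A z)) x p) \<or>
      (\<exists>p. supergradient (\<lambda>z. - dist_nu \<nu> C (A z)) x p)" for x
  proof (cases "A x \<in> C")
    case True
    have "\<exists>p. supergradient (\<lambda>z. - dist_nu \<nu> C (A z)) x p"
      by (rule supergradient_touching_above[OF has_derivative_const[of 0]])
        (auto simp: best_approx_in_set[OF \<nu> True] dist_nu_nonneg[OF \<nu> C(2)])
    then show ?thesis ..
  next
    case False
    obtain y where y: "y \<in> C" "\<nu> (A x - y) = dist_nu \<nu> C (A x)"
      using best_approx_exists[OF \<nu> C] unfolding best_approx_def by blast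
    have "A x - y \<noteq> 0" using False y(1) by auto
    then have "(\<nu> has_derivative frechet_derivative \<nu> (at (A x - y))) (at (A x - y))"
      by (rule differentiable_norm_has_derivative[OF diff])
    moreover have "((\<lambda>z. A z - y) has_derivative A) (at x)"
      by (auto intro!: derivative_eq_intros bounded_linear_imp_has_derivative A)
    ultimately have "((\<lambda>z. \<nu> (A z - y)) has_derivative
        (\<lambda>h. frechet_derivative \<nu> (at (A x - y)) (A h))) (at x)"
      by (rule has_derivative_compose[rotated])
    then have "\<exists>p. supergradient (\<lambda>z. dist_nu \<nu> C (A z)) x p"
      by (rule supergradient_touching_above) (use y dist_nu_le[OF \<nu>] in auto)
    then show ?thesis ..
  qed
  ultimately show ?thesis by (rule lipschitz_semidifferentiable_imp_differentiable_ae)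
qed

section \<open>The differential of the distance\<close>

text \<open>The difference \<open>g - f\<close> has a minimum at \<open>x\<close> along every line in \<open>U\<close>. Restricting to lines turns differentiability
relative to \<open>U\<close> into ordinary differentiability of a function of one real variable.\<close>

lemma derivative_eq_of_touching_above:
  fixes f g :: "'a::real_normed_vector \<Rightarrow> real"
  assumes U: "subspace U" and x: "x \<in> U" and u: "u \<in> U"
    and f: "(f has_derivative D) (at x within U)" and g: "(g has_derivative D') (at x)"
    and eq: "f x = g x" and le: "\<And>w. w \<in> U \<Longrightarrow> f w \<le> g w"
  shows "D u = D' u"
proof -
  have line: "x + t *\<^sub>R u \<in> U" for t :: real
    using U x u by (intro subspace_add subspace_scale)
  have dl: "((\<lambda>t::real. x + t *\<^sub>R u) has_derivative (\<lambda>t. t *\<^sub>R u)) (at 0)"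
    by (auto intro!: derivative_eq_intros)
  have "((\<lambda>t. f (x + t *\<^sub>R u)) has_derivative (\<lambda>t. D (t *\<^sub>R u))) (at 0)"
    by (rule has_derivative_in_compose[OF dl]) (use f line in \<open>auto intro: has_derivative_subset\<close>)
  moreover have "((\<lambda>t. g (x + t *\<^sub>R u)) has_derivative (\<lambda>t. D' (t *\<^sub>R u))) (at 0)"
    by (rule has_derivative_compose[OF dl]) (use g in simp)
  ultimately have "((\<lambda>t. g (x + t *\<^sub>R u) - f (x + t *\<^sub>R u)) has_derivative
      (\<lambda>t. D' (t *\<^sub>R u) - D (t *\<^sub>R u))) (at 0)"
    by (rule has_derivative_diff[rotated])
  then have "(\<lambda>t. D' (t *\<^sub>R u) - D (t *\<^sub>R u)) = (\<lambda>t. 0)"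
    by (rule has_derivative_local_min) (use eq le[OF line] in simp)
  from fun_cong[OF this, of 1] show ?thesis by simp
qed

lemma dist_nu_derivative:
  fixes \<nu> :: "real ^ 'n \<Rightarrow> real"
  assumes \<nu>: "is_norm \<nu>" and diff: "differentiable_norm \<nu>"
    and U: "subspace U" and x: "x \<in> U" "x \<notin> C" and u: "u \<in> U"
    and y: "best_approx \<nu> C x y"
    and D: "(dist_nu \<nu> C has_derivative D) (at x within U)"
  shows "D u = row_differential \<nu> (x - y) \<bullet> u"
proof -
  have y': "y \<in> C" "\<nu> (x - y) = dist_nu \<nu> C x" using y unfolding best_approx_def by auto
  have "x - y \<noteq> 0" using x y' by auto
  note d\<nu> = differentiable_norm_has_derivative[OF diff this]
  have "((\<lambda>w. \<nu> (w - y)) has_derivative frechet_derivative \<nu> (at (x - y))) (at x)"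
    by (rule has_derivative_compose[of "\<lambda>w. w - y" "\<lambda>h. h", OF _ d\<nu>])
      (auto intro!: derivative_eq_intros)
  from derivative_eq_of_touching_above[OF U x(1) u D this]
  have "D u = frechet_derivative \<nu> (at (x - y)) u"
    using y' dist_nu_le[OF \<nu> y'(1)] by auto
  also have "\<dots> = row_differential \<nu> (x - y) \<bullet> u"
    using d\<nu> by (intro frechet_derivative_eq_row_differential) (auto simp: differentiable_def)
  finally show ?thesis .
qed

section \<open>Uniqueness of best approximations\<close>

text \<open>For positive steps, by homogeneity the difference quotients at \<open>v\<close> in the direction \<open>v\<close> are constantly \<open>\<nu> v\<close>, and by the
triangle inequality those in the direction \<open>u\<close> are at most \<open>\<nu> u\<close>. In other words, the gradient has dual norm
\<open>1\<close>, and the direction of \<open>v\<close> attains it.\<close>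

lemma row_differential_supports_norm:
  fixes \<nu> :: "real ^ 'n \<Rightarrow> real"
  assumes \<nu>: "is_norm \<nu>" and diff: "differentiable_norm \<nu>" and v: "v \<noteq> 0"
  shows "row_differential \<nu> v \<bullet> v = \<nu> v" and "row_differential \<nu> v \<bullet> u \<le> \<nu> u"
proof -
  let ?D = "frechet_derivative \<nu> (at v)"
  note d\<nu> = differentiable_norm_has_derivative[OF diff v]
  have row: "?D h = row_differential \<nu> v \<bullet> h" for h
    using d\<nu> by (intro frechet_derivative_eq_row_differential) (auto simp: differentiable_def)
  have line: "((\<lambda>t. \<nu> (v + t *\<^sub>R h)) has_real_derivative ?D h) (at 0)" for h
  proof -
    have "((\<lambda>t. \<nu> (v + t *\<^sub>R h)) has_derivative (\<lambda>t. ?D (t *\<^sub>R h))) (at 0)"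
      by (rule has_derivative_compose[of "\<lambda>t. v + t *\<^sub>R h" "\<lambda>t. t *\<^sub>R h"])
        (use d\<nu> in \<open>auto intro!: derivative_eq_intros\<close>)
    then show ?thesis
      by (simp add: has_field_derivative_def row mult_commute_abs)
  qed
  have slope: "((\<lambda>t. (\<nu> (v + t *\<^sub>R h) - \<nu> v) / t) \<longlongrightarrow> ?D h) (at_right 0)" for h
    using line[of h] unfolding DERIV_def by (auto intro: tendsto_mono[OF at_le])
  have "\<forall>\<^sub>F t in at_right 0. (\<nu> (v + t *\<^sub>R u) - \<nu> v) / t \<le> \<nu> u"
  proof (rule eventually_at_right_less[THEN eventually_mono])
    fix t :: real assume "0 < t"
    then have "\<nu> (v + t *\<^sub>R u) \<le> \<nu> v + t * \<nu> u"
      using is_norm_triangle[OF \<nu>, of v "t *\<^sub>R u"] is_norm_scale[OF \<nu>, of t u] by simp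
    then show "(\<nu> (v + t *\<^sub>R u) - \<nu> v) / t \<le> \<nu> u" using \<open>0 < t\<close> by (simp add: field_simps)
  qed
  from tendsto_upperbound[OF slope this] show "row_differential \<nu> v \<bullet> u \<le> \<nu> u"
    by (simp add: row)
  have "\<forall>\<^sub>F t in at_right 0. (\<nu> (v + t *\<^sub>R v) - \<nu> v) / t = \<nu> v"
  proof (rule eventually_at_right_less[THEN eventually_mono])
    fix t :: real assume "0 < t"
    then have "\<nu> (v + t *\<^sub>R v) = (1 + t) * \<nu> v"
      using is_norm_scale[OF \<nu>, of "1 + t" v] by (simp add: algebra_simps)
    then show "(\<nu> (v + t *\<^sub>R v) - \<nu> v) / t = \<nu> v" using \<open>0 < t\<close> by (simp add: field_simps)
  qed
  then have "((\<lambda>t. (\<nu> (v + t *\<^sub>R v) - \<nu> v) / t) \<longlongrightarrow> \<nu> v) (at_right 0)"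
    by (rule tendsto_eventually)
  from tendsto_unique[OF _ slope this] show "row_differential \<nu> v \<bullet> v = \<nu> v"
    by (simp add: row)
qed

text \<open>The functional given by a point that attains the dual norm of \<open>p\<close> touches the dual norm from below at \<open>p\<close>.\<close>

lemma dual_norm_derivative_eq:
  fixes \<nu> :: "real ^ 'n \<Rightarrow> real"
  assumes \<nu>: "is_norm \<nu>" and w: "\<nu> w = 1" "w \<bullet> p = dual_norm \<nu> p"
    and D: "(dual_norm \<nu> has_derivative D) (at p)"
  shows "D h = w \<bullet> h"
proof -
  have above: "((\<lambda>q. - (w \<bullet> q)) has_derivative (\<lambda>h. - (w \<bullet> h))) (at p)"
    by (auto intro!: derivative_eq_intros)
  have below: "((\<lambda>q. - dual_norm \<nu> q) has_derivative (\<lambda>h. - D h)) (at p within UNIV)"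
    using D by (auto intro!: derivative_eq_intros)
  have "- D h = - (w \<bullet> h)"
    by (rule derivative_eq_of_touching_above[OF subspace_UNIV UNIV_I UNIV_I below above])
      (use w dual_norm_upper[OF \<nu>] in auto)
  then show ?thesis by simp
qed

text \<open>The unit vectors in the directions of \<open>v\<close> and \<open>w\<close> both attain the dual norm of the common gradient. A
differentiable dual norm has only one such vector at each nonzero point, namely its own gradient.\<close>

lemma row_differential_determines_direction:
  fixes \<nu> :: "real ^ 'n \<Rightarrow> real"
  assumes \<nu>: "is_norm \<nu>" and diff: "differentiable_norm \<nu>"
    and dual: "differentiable_norm (dual_norm \<nu>)"
    and nz: "v \<noteq> 0" "w \<noteq> 0" and eq: "row_differential \<nu> v = row_differential \<nu> w"
  shows "(1 / \<nu> v) *\<^sub>R v = (1 / \<nu> w) *\<^sub>R w"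
proof -
  define p where "p = row_differential \<nu> v"
  have pos: "0 < \<nu> a" if "a \<noteq> 0" for a
    using is_norm_nonneg[OF \<nu>, of a] is_norm_eq_0[OF \<nu>, of a] that by linarith
  have unit: "\<nu> ((1 / \<nu> a) *\<^sub>R a) = 1" if "a \<noteq> 0" for a
    using is_norm_scale[OF \<nu>, of "1 / \<nu> a" a] pos[OF that] by simp
  have "dual_norm \<nu> p \<le> 1"
  proof -
    obtain y where "\<nu> y = 1" "y \<bullet> p = dual_norm \<nu> p"
      using dual_norm_attained[OF \<nu>] by blast
    then show ?thesis
      using row_differential_supports_norm(2)[OF \<nu> diff nz(1), of y]
      by (simp add: p_def inner_commute)
  qed
  moreover have att: "((1 / \<nu> a) *\<^sub>R a) \<bullet> p = 1" if "a \<noteq> 0" "p = row_differential \<nu> a" for a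
    using row_differential_supports_norm(1)[OF \<nu> diff that(1)] pos[OF that(1)] that(2)
    by (simp add: inner_commute)
  moreover have "1 \<le> dual_norm \<nu> p"
    using dual_norm_upper[OF \<nu> unit[OF nz(1)], of p] att[OF nz(1) p_def] by simp
  ultimately have one: "dual_norm \<nu> p = 1" by simp
  have "p \<noteq> 0" using att[OF nz(1) p_def] by auto
  note D = differentiable_norm_has_derivative[OF dual this]
  have "((1 / \<nu> v) *\<^sub>R v) \<bullet> h = ((1 / \<nu> w) *\<^sub>R w) \<bullet> h" for h
    using dual_norm_derivative_eq[OF \<nu> unit[OF nz(1)] _ D, of h]
      dual_norm_derivative_eq[OF \<nu> unit[OF nz(2)] _ D, of h]
      att[OF nz(1) p_def] att[OF nz(2)] eq one p_def by simp
  then show ?thesis by (rule iffD1[OF vector_eq_rdot, OF allI])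
qed

text \<open>Outside \<open>C\<close>, the differential of the distance determines the gradient of \<open>\<nu>\<close> at \<open>x - y\<close>, hence the direction of
\<open>x - y\<close>, and the length of \<open>x - y\<close> is the distance itself.\<close>

lemma best_approx_unique:
  fixes \<nu> :: "real ^ 'n \<Rightarrow> real"
  assumes \<nu>: "is_norm \<nu>" and diff: "differentiable_norm \<nu>"
    and dual: "differentiable_norm (dual_norm \<nu>)"
    and d: "dist_nu \<nu> C differentiable (at x)"
    and y: "best_approx \<nu> C x y" and z: "best_approx \<nu> C x z"
  shows "y = z"
proof (cases "x \<in> C")
  case True
  then show ?thesis using y z best_approx_in_set(2)[OF \<nu> True] by simp
next
  case False
  obtain D where D: "(dist_nu \<nu> C has_derivative D) (at x within UNIV)"
    using d unfolding differentiable_def by auto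
  have "row_differential \<nu> (x - y) \<bullet> h = row_differential \<nu> (x - z) \<bullet> h" for h
    using dist_nu_derivative[OF \<nu> diff subspace_UNIV UNIV_I False UNIV_I y D, of h]
      dist_nu_derivative[OF \<nu> diff subspace_UNIV UNIV_I False UNIV_I z D, of h] by simp
  then have eq: "row_differential \<nu> (x - y) = row_differential \<nu> (x - z)"
    by (rule iffD1[OF vector_eq_rdot, OF allI])
  have yz: "y \<in> C" "z \<in> C" "\<nu> (x - y) = \<nu> (x - z)"
    using y z unfolding best_approx_def by auto
  then have nz: "x - y \<noteq> 0" "x - z \<noteq> 0" using False by auto
  then have "\<nu> (x - z) \<noteq> 0" using is_norm_eq_0[OF \<nu>] by blast
  moreover have "(1 / \<nu> (x - z)) *\<^sub>R (x - y) = (1 / \<nu> (x - z)) *\<^sub>R (x - z)"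
    using row_differential_determines_direction[OF \<nu> diff dual nz eq] unfolding yz(3) .
  ultimately have "x - y = x - z" by (simp only: scaleR_cancel_left) auto
  then show ?thesis by simp
qed

section \<open>Differentiability and best approximation\<close>

theorem theorem2p1:
  fixes \<nu> :: "real ^ 'n \<Rightarrow> real"
    and C U :: "(real ^ 'n) set"
    and d :: "real ^ 'n \<Rightarrow> real"
  assumes "is_norm \<nu>" and "differentiable_norm \<nu>"
    and "closed C" and "C \<noteq> {}" and "C \<noteq> UNIV"
    and "subspace U" and "dim U \<in> {1..CARD('n)}" and "\<not> U \<subseteq> C"
    and "\<And>x. x \<in> U \<Longrightarrow> d x = dist_nu \<nu> C x"
  shows
    "((\<forall>x z. \<bar>dist_nu \<nu> C x - dist_nu \<nu> C z\<bar> \<le> \<nu> (x - z)) \<and>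
      (\<exists>L. L-lipschitz_on UNIV (dist_nu \<nu> C))) \<and>
     (\<forall>B. orthonormal_basis_of B U \<longrightarrow>
        (AE x in lborel_span B. d differentiable (at x within U))) \<and>
     (\<forall>x\<in>U - C. d differentiable (at x within U) \<longrightarrow>
        (\<forall>y. best_approx \<nu> C x y \<longrightarrow>
           (\<forall>D. (d has_derivative D) (at x within U) \<longrightarrow>
              (\<forall>u\<in>U. D u = row_differential \<nu> (x - y) \<bullet> u)) \<and>
           (\<forall>z. best_approx \<nu> C x z \<longrightarrow>
              (\<forall>u\<in>U. orthogonal (row_differential \<nu> (x - z) - row_differential \<nu> (x - y)) u)))) \<and>
     (differentiable_norm (dual_norm \<nu>) \<longrightarrow>
        (\<forall>x. dist_nu \<nu> C differentiable (at x) \<longrightarrow> (\<exists>!y. best_approx \<nu> C x y)))"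
proof (intro conjI)
  note \<nu> = assms(1) and diff = assms(2) and C = assms(3,4) and U = assms(6) and d = assms(9)
  show "\<forall>x z. \<bar>dist_nu \<nu> C x - dist_nu \<nu> C z\<bar> \<le> \<nu> (x - z)"
    using dist_nu_abs_diff_le[OF \<nu> C] by blast
  show "\<exists>L. L-lipschitz_on UNIV (dist_nu \<nu> C)"
    by (rule dist_nu_lipschitz[OF \<nu> C])
  have transfer: "(dist_nu \<nu> C has_derivative D) (at x within U)"
    if "x \<in> U" "(d has_derivative D) (at x within U)" for x D
    by (rule has_derivative_transform[OF that(1) _ that(2)]) (simp add: d)
  show "\<forall>B. orthonormal_basis_of B U \<longrightarrow> (AE x in lborel_span B. d differentiable (at x within U))"
  proof (intro allI impI)
    fix B assume B: "orthonormal_basis_of B U"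
    then have span: "span B = U" unfolding orthonormal_basis_of_def by simp
    obtain I \<pi> where "orthonormal_frame B I \<pi>"
      using orthonormal_frame_exists[OF B] .
    then interpret orthonormal_frame B I \<pi> .
    have "AE x in lborel_span B. dist_nu \<nu> C differentiable (at x within span B)"
      by (intro AE_lborel_span_differentiable negligible_dist_nu_not_differentiable
          \<nu> diff C bounded_linear_to_span)
    then show "AE x in lborel_span B. d differentiable (at x within U)"
    proof (rule AE_mp, intro AE_I2 impI)
      fix x assume "x \<in> space (lborel_span B)" "dist_nu \<nu> C differentiable (at x within span B)"
      then obtain D where x: "x \<in> U" and D: "(dist_nu \<nu> C has_derivative D) (at x within U)"
        unfolding lborel_span_def span differentiable_def by (auto simp: space_restrict_space)
      have "(d has_derivative D) (at x within U)"
        by (rule has_derivative_transform[OF x d D])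
      then show "d differentiable (at x within U)"
        unfolding differentiable_def by blast
    qed
  qed
  show "\<forall>x\<in>U - C. d differentiable (at x within U) \<longrightarrow>
        (\<forall>y. best_approx \<nu> C x y \<longrightarrow>
           (\<forall>D. (d has_derivative D) (at x within U) \<longrightarrow>
              (\<forall>u\<in>U. D u = row_differential \<nu> (x - y) \<bullet> u)) \<and>
           (\<forall>z. best_approx \<nu> C x z \<longrightarrow>
              (\<forall>u\<in>U. orthogonal (row_differential \<nu> (x - z) - row_differential \<nu> (x - y)) u)))"
  proof (intro ballI impI)
    fix x assume x: "x \<in> U - C" and dd: "d differentiable (at x within U)"
    then have x': "x \<in> U" "x \<notin> C" by auto
    have grad: "D u = row_differential \<nu> (x - y) \<bullet> u"
      if "best_approx \<nu> C x y" "(d has_derivative D) (at x within U)" "u \<in> U" for y D u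
      by (rule dist_nu_derivative[OF \<nu> diff U x' that(3,1) transfer[OF x'(1) that(2)]])
    obtain D where D: "(d has_derivative D) (at x within U)"
      using dd unfolding differentiable_def by blast
    show "\<forall>y. best_approx \<nu> C x y \<longrightarrow>
           (\<forall>D. (d has_derivative D) (at x within U) \<longrightarrow>
              (\<forall>u\<in>U. D u = row_differential \<nu> (x - y) \<bullet> u)) \<and>
           (\<forall>z. best_approx \<nu> C x z \<longrightarrow>
              (\<forall>u\<in>U. orthogonal (row_differential \<nu> (x - z) - row_differential \<nu> (x - y)) u))"
    proof (intro allI impI conjI ballI)
      fix y z u assume "best_approx \<nu> C x y" "best_approx \<nu> C x z" "u \<in> U"
      then show "orthogonal (row_differential \<nu> (x - z) - row_differential \<nu> (x - y)) u"
        using grad[OF _ D, of y u] grad[OF _ D, of z u]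
        by (simp add: orthogonal_def inner_diff_left)
    qed (rule grad)
  qed
  show "differentiable_norm (dual_norm \<nu>) \<longrightarrow>
        (\<forall>x. dist_nu \<nu> C differentiable (at x) \<longrightarrow> (\<exists>!y. best_approx \<nu> C x y))"
    using best_approx_exists[OF \<nu> C] best_approx_unique[OF \<nu> diff] by metis
qed

end
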